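(* Let $M$ be an oriented matroid on a linearly ordered finite set $E$, with $\iota$ dual-active elements and $\varepsilon$ active elements. The $2^{\iota+\varepsilon}$ reorientations of $M$ obtained by reorienting any union of parts of the active partition of $M$ have the same active filtration (and active partition) as $M$, and hence the same active and dual-active elements.
   Context: $\subset$ is strict inclusion. For $A\subseteq E$, $-_AM$ is the oriented matroid obtained by reorienting $A$; reorientations of $M$ are indexed by subsets $A\subseteq E$. Signed circuits and cocircuits come in opposite pairs; one is positive if all its signs are positive. The set of dual-active elements $O^*(M)=\{a_1<\dots<a_\iota\}$ is the set of smallest elements of positive cocircuits of $M$; the set of active elements $O(M)=\{a'_1<\dots<a'_\varepsilon\}$ is the set of smallest elements of positive circuits of $M$. Active filtration of $M$: $\emptyset=F'_\varepsilon\subset\cdots\subset F'_0=F_c=F_0\subset\cdots\subset F_\iota=E$ where $F_c$ is the union of all positive circuits of $M$; $F'_k$ is the union of all positive circuits $C$ with $\min(C)\ge a'_{k+1}$, for $0\le k\le\varepsilon-1$; $F_k$ is the complement in $E$ of the union of all positive cocircuits $D$ with $\min(D)\ge a_{k+1}$, for $0\le k\le\iota-1$. The active partition of $M$ is the partition of $E$ into the $\iota+\varepsilon$ parts $F'_{k-1}\setminus F'_k$ ($1\le k\le\varepsilon$) and $F_k\setminus F_{k-1}$ ($1\le k\le\iota$), given together with $F_c$. *)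

theory Defs
  imports Main
begin

text \<open>A signed set is the pair of its positive and negative parts.\<close>

type_synonym 'a signed = "'a set \<times> 'a set"

definition supp :: "'a signed \<Rightarrow> 'a set" where
  "supp X = fst X \<union> snd X"

definition opp :: "'a signed \<Rightarrow> 'a signed" where
  "opp X = (snd X, fst X)"

definition signed_on :: "'a set \<Rightarrow> 'a signed \<Rightarrow> bool" where
  "signed_on E X \<longleftrightarrow> supp X \<subseteq> E \<and> fst X \<inter> snd X = {}"

definition positive :: "'a signed \<Rightarrow> bool" where
  "positive X \<longleftrightarrow> snd X = {}"

text \<open>An oriented matroid on \<open>E\<close> is given by its set \<open>C\<close> of signed circuits. The axioms are the
  signed circuit axioms of Bjorner, Las Vergnas, Sturmfels, White and Ziegler.\<close>

locale oriented_matroid =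
  fixes E :: "'a set" and C :: "'a signed set"
  assumes finite_ground: "finite E"
    and signed_circuits: "X \<in> C \<Longrightarrow> signed_on E X"
    and nonempty: "X \<in> C \<Longrightarrow> supp X \<noteq> {}"
    and symmetric: "X \<in> C \<Longrightarrow> opp X \<in> C"
    and incomparable: "X \<in> C \<Longrightarrow> Y \<in> C \<Longrightarrow> supp X \<subseteq> supp Y \<Longrightarrow> X = Y \<or> X = opp Y"
    and elimination: "X \<in> C \<Longrightarrow> Y \<in> C \<Longrightarrow> X \<noteq> opp Y \<Longrightarrow> e \<in> fst X \<inter> snd Y \<Longrightarrow>
      \<exists>Z\<in>C. fst Z \<subseteq> (fst X \<union> fst Y) - {e} \<and> snd Z \<subseteq> (snd X \<union> snd Y) - {e}"

definition reorient_signed :: "'a set \<Rightarrow> 'a signed \<Rightarrow> 'a signed" where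
  "reorient_signed A X = ((fst X - A) \<union> (snd X \<inter> A), (snd X - A) \<union> (fst X \<inter> A))"

definition reorient :: "'a set \<Rightarrow> 'a signed set \<Rightarrow> 'a signed set" where
  "reorient A C = reorient_signed A ` C"

definition independent :: "'a set \<Rightarrow> 'a signed set \<Rightarrow> 'a set \<Rightarrow> bool" where
  "independent E C I \<longleftrightarrow> I \<subseteq> E \<and> (\<forall>X\<in>C. \<not> supp X \<subseteq> I)"

definition basis :: "'a set \<Rightarrow> 'a signed set \<Rightarrow> 'a set \<Rightarrow> bool" where
  "basis E C B \<longleftrightarrow> independent E C B \<and> (\<forall>I. independent E C I \<longrightarrow> B \<subseteq> I \<longrightarrow> I = B)"

text \<open>Independence in the dual of the underlying matroid, whose bases are the complements of bases.\<close>

definition coindependent :: "'a set \<Rightarrow> 'a signed set \<Rightarrow> 'a set \<Rightarrow> bool" where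
  "coindependent E C J \<longleftrightarrow> (\<exists>B. basis E C B \<and> J \<subseteq> E - B)"

definition underlying_cocircuit :: "'a set \<Rightarrow> 'a signed set \<Rightarrow> 'a set \<Rightarrow> bool" where
  "underlying_cocircuit E C D \<longleftrightarrow>
     D \<subseteq> E \<and> \<not> coindependent E C D \<and> (\<forall>D'. D' \<subset> D \<longrightarrow> coindependent E C D')"

text \<open>On the common support, the two signed sets neither agree nor are opposite.\<close>

definition orthogonal :: "'a signed \<Rightarrow> 'a signed \<Rightarrow> bool" where
  "orthogonal X Y \<longleftrightarrow> supp X \<inter> supp Y = {} \<or>
     ((fst X \<inter> fst Y) \<union> (snd X \<inter> snd Y) \<noteq> {} \<and> (fst X \<inter> snd Y) \<union> (snd X \<inter> fst Y) \<noteq> {})"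

text \<open>The signed cocircuits form the unique signature of the cocircuits of the underlying matroid
  that is closed under \<^term>\<open>opp\<close> and orthogonal to the signed circuits.\<close>

definition cocircuits :: "'a set \<Rightarrow> 'a signed set \<Rightarrow> 'a signed set" where
  "cocircuits E C =
     {Y. signed_on E Y \<and> underlying_cocircuit E C (supp Y) \<and> (\<forall>X\<in>C. orthogonal X Y)}"

definition active :: "('a::linorder) signed set \<Rightarrow> 'a set" where
  "active C = {Min (supp X) | X. X \<in> C \<and> positive X}"

definition dual_active :: "('a::linorder) set \<Rightarrow> 'a signed set \<Rightarrow> 'a set" where
  "dual_active E C = {Min (supp Y) | Y. Y \<in> cocircuits E C \<and> positive Y}"

definition cyclic_part :: "'a signed set \<Rightarrow> 'a set" where
  "cyclic_part C = \<Union> {supp X | X. X \<in> C \<and> positive X}"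

text \<open>Lists are indexed from 0, so \<open>a'\<close> and \<open>a\<close> with index \<open>k + 1\<close> are the entries at \<open>k\<close>.
  \<open>cyclic_flat C k\<close> is $F'_k$ and \<open>acyclic_flat E C k\<close> is $F_k$.\<close>

definition cyclic_flat :: "('a::linorder) signed set \<Rightarrow> nat \<Rightarrow> 'a set" where
  "cyclic_flat C k =
     (if k < card (active C)
      then \<Union> {supp X | X. X \<in> C \<and> positive X \<and> sorted_list_of_set (active C) ! k \<le> Min (supp X)}
      else {})"

definition acyclic_flat :: "('a::linorder) set \<Rightarrow> 'a signed set \<Rightarrow> nat \<Rightarrow> 'a set" where
  "acyclic_flat E C k =
     (if k < card (dual_active E C)
      then E - \<Union> {supp Y | Y. Y \<in> cocircuits E C \<and> positive Y \<and>
                              sorted_list_of_set (dual_active E C) ! k \<le> Min (supp Y)}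
      else E)"

text \<open>The increasing sequence is stored as its two halves, with the cyclic part $F_c$ between them.\<close>

definition active_filtration ::
  "('a::linorder) set \<Rightarrow> 'a signed set \<Rightarrow> 'a set list \<times> 'a set \<times> 'a set list" where
  "active_filtration E C =
     (map (cyclic_flat C) (rev [0..<Suc (card (active C))]),
      cyclic_part C,
      map (acyclic_flat E C) [0..<Suc (card (dual_active E C))])"

definition active_parts :: "('a::linorder) set \<Rightarrow> 'a signed set \<Rightarrow> 'a set set" where
  "active_parts E C =
     {cyclic_flat C (k - 1) - cyclic_flat C k | k. k \<in> {1..card (active C)}} \<union>
     {acyclic_flat E C k - acyclic_flat E C (k - 1) | k. k \<in> {1..card (dual_active E C)}}"

definition active_partition ::
  "('a::linorder) set \<Rightarrow> 'a signed set \<Rightarrow> 'a set set \<times> 'a set" where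
  "active_partition E C = (active_parts E C, cyclic_part C)"

end

theory Submission
  imports Defs
begin

text \<open>Let \<open>U\<^sub>a\<close> be the union of the positive circuits contained in \<open>{a..}\<close>. The element \<open>a\<close> is active
  iff \<open>a \<in> U\<^sub>a\<close>, so the flats \<open>U\<^sub>a\<close> and their duals determine the active filtration, and it suffices
  that reorienting a union of parts fixes all of them. If a flat changed, the painting property would
  give a signed circuit and a signed cocircuit meeting inside a single part. The reorientation
  acts there by one sign, so the two have constant relative sign on their intersection, against
  orthogonality. Painting and orthogonality are symmetric in circuits and cocircuits, so the dual
  half is the same statement. Painting is reduced by induction to the existence, for each hyperplane,
  of a signature of its complement that is orthogonal to all circuits.\<close>

lemma supp_opp [simp]: "supp (opp X) = supp X"
  by (auto simp: supp_def opp_def)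

lemma fst_opp [simp]: "fst (opp X) = snd X"
  by (simp add: opp_def)

lemma snd_opp [simp]: "snd (opp X) = fst X"
  by (simp add: opp_def)

lemma opp_opp [simp]: "opp (opp X) = X"
  by (simp add: opp_def)

lemma in_supp_iff: "x \<in> supp X \<longleftrightarrow> x \<in> fst X \<or> x \<in> snd X"
  by (simp add: supp_def)

section \<open>Circuits and hyperplanes\<close>

context oriented_matroid
begin

lemma supp_subset_ground: "X \<in> C \<Longrightarrow> supp X \<subseteq> E"
  using signed_circuits by (auto simp: signed_on_def)

lemma finite_supp: "X \<in> C \<Longrightarrow> finite (supp X)"
  using supp_subset_ground finite_ground finite_subset by blast

lemma signs_disjoint: "X \<in> C \<Longrightarrow> x \<in> fst X \<Longrightarrow> x \<notin> snd X"
  using signed_circuits by (fastforce simp: signed_on_def)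

lemma supp_eqI: "X \<in> C \<Longrightarrow> Y \<in> C \<Longrightarrow> supp X \<subseteq> supp Y \<Longrightarrow> supp X = supp Y"
  using incomparable by fastforce

lemma circuit_with_sign:
  assumes "X \<in> C" "e \<in> supp X"
  obtains X' where "X' \<in> C" "supp X' = supp X" "e \<in> fst X'"
  using assms symmetric[of X] in_supp_iff[of e X] by (metis fst_opp supp_opp)

lemma weak_elimination:
  assumes "X \<in> C" "Y \<in> C" "supp X \<noteq> supp Y" "e \<in> supp X" "e \<in> supp Y"
  obtains Z where "Z \<in> C" "supp Z \<subseteq> supp X \<union> supp Y - {e}"
proof -
  obtain X' where X': "X' \<in> C" "supp X' = supp X" "e \<in> fst X'"
    using circuit_with_sign assms by metis
  obtain Y' where Y': "Y' \<in> C" "supp Y' = supp Y" "e \<in> fst Y'"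
    using circuit_with_sign assms by metis
  have "X' \<noteq> opp (opp Y')" using X' Y' assms(3) by auto
  then obtain Z where "Z \<in> C" "fst Z \<subseteq> (fst X' \<union> fst (opp Y')) - {e}"
      "snd Z \<subseteq> (snd X' \<union> snd (opp Y')) - {e}"
    using elimination[of X' "opp Y'" e] X' Y' symmetric by auto
  then show thesis using that[of Z] X' Y' by (auto simp: supp_def)
qed

text \<open>If the weak eliminant \<open>Z1\<close> misses \<open>f\<close>, it contains some
  \<open>g\<close> outside \<open>supp X\<close>. Eliminate \<open>g\<close> from \<open>Y\<close>
  and \<open>Z1\<close> keeping \<open>e\<close>, then \<open>e\<close> from \<open>X\<close> and
  the result keeping \<open>f\<close>. The unions involved miss \<open>f\<close> and
  \<open>g\<close> respectively, so induction applies.\<close>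

lemma strong_elimination:
  assumes "X \<in> C" "Y \<in> C" "e \<in> supp X" "e \<in> supp Y" "f \<in> supp X" "f \<notin> supp Y"
  shows "\<exists>Z\<in>C. f \<in> supp Z \<and> supp Z \<subseteq> supp X \<union> supp Y - {e}"
  using assms
proof (induction "card (supp X \<union> supp Y)" arbitrary: X Y e f rule: less_induct)
  case less
  note IH = less.hyps
  have smaller: "card S < card (supp X \<union> supp Y)" if "S \<subseteq> supp X \<union> supp Y - {x}"
      "x \<in> supp X \<union> supp Y" for S x
    using that finite_supp[OF less.prems(1)] finite_supp[OF less.prems(2)] by (intro psubset_card_mono) auto
  obtain Z1 where Z1: "Z1 \<in> C" "supp Z1 \<subseteq> supp X \<union> supp Y - {e}"
    using weak_elimination[of X Y e] less.prems by blast
  show ?case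
  proof (cases "f \<in> supp Z1")
    case False
    obtain g where g: "g \<in> supp Z1" "g \<notin> supp X"
      using supp_eqI[of Z1 X] Z1 False less.prems by blast
    have "card (supp Y \<union> supp Z1) < card (supp X \<union> supp Y)"
      by (rule smaller[of _ f]) (use Z1 False less.prems in blast)+
    then obtain Z2 where Z2: "Z2 \<in> C" "e \<in> supp Z2" "supp Z2 \<subseteq> supp Y \<union> supp Z1 - {g}"
      using IH[of Y Z1 g e] Z1 g less.prems by blast
    have "card (supp X \<union> supp Z2) < card (supp X \<union> supp Y)"
      by (rule smaller[of _ g]) (use Z1 Z2 g less.prems in blast)+
    moreover have "f \<notin> supp Z2" using Z2 False less.prems by blast
    ultimately obtain Z where "Z \<in> C" "f \<in> supp Z" "supp Z \<subseteq> supp X \<union> supp Z2 - {e}"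
      using IH[of X Z2 e f] Z2 less.prems by blast
    then show ?thesis using Z1 Z2 by blast
  qed (use Z1 in blast)
qed

end

section \<open>The signature of the complement of a hyperplane\<close>

text \<open>\<open>H\<close> is maximal among the sets that do not span \<open>e\<close>, that is, a hyperplane avoiding \<open>e\<close>.\<close>

locale pointed_hyperplane = oriented_matroid E C for E :: "'a set" and C +
  fixes H :: "'a set" and e :: 'a
  assumes hyperplane_subset: "H \<subseteq> E"
    and point: "e \<in> E - H"
    and not_spanned: "X \<in> C \<Longrightarrow> e \<in> supp X \<Longrightarrow> \<not> supp X \<subseteq> insert e H"
    and spanned: "f \<in> E - H \<Longrightarrow> f \<noteq> e \<Longrightarrow> \<exists>X\<in>C. e \<in> supp X \<and> supp X \<subseteq> {e, f} \<union> H"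
begin

text \<open>Modulo \<open>H\<close> the elements outside \<open>H\<close> are pairwise parallel. A
  link is a circuit witnessing this for \<open>e\<close> and \<open>f\<close>; its relative sign
  there dictates the one in the cocircuit.\<close>

definition link :: "'a \<Rightarrow> 'a signed \<Rightarrow> bool" where
  "link f X \<longleftrightarrow> X \<in> C \<and> f \<noteq> e \<and> supp X - H = {e, f}"

lemma linkI: "X \<in> C \<Longrightarrow> f \<noteq> e \<Longrightarrow> f \<notin> H \<Longrightarrow> e \<in> supp X \<Longrightarrow> supp X \<subseteq> {e, f} \<union> H \<Longrightarrow> link f X"
  using not_spanned[of X] point by (auto simp: link_def)

lemma linkD:
  assumes "link f X"
  shows "X \<in> C" "f \<noteq> e" "f \<in> E" "f \<notin> H" "e \<in> supp X" "f \<in> supp X" "supp X \<subseteq> {e, f} \<union> H"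
  using assms supp_subset_ground[of X] unfolding link_def by blast+

lemma link_opp: "link f X \<Longrightarrow> link f (opp X)"
  by (simp add: link_def symmetric)

lemma link_exists: "f \<in> E - H \<Longrightarrow> f \<noteq> e \<Longrightarrow> \<exists>X. link f X"
  using spanned[of f] linkI[of _ f] by blast

text \<open>Eliminating \<open>f\<close> between a link and \<open>X\<close> while keeping
  \<open>e\<close> would leave a circuit through \<open>e\<close> inside \<open>insert e H\<close>.
  In other words, \<open>H\<close> is closed.\<close>

lemma no_single_intersection:
  assumes "X \<in> C" "f \<in> supp X" "supp X \<subseteq> insert f H"
  shows "f \<in> H"
proof (rule ccontr)
  assume f: "f \<notin> H"
  have "f \<noteq> e" using not_spanned assms by blast
  moreover have "f \<in> E" using assms supp_subset_ground by blast
  ultimately obtain X' where X': "link f X'" using link_exists f by blast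
  note X' = linkD[OF X']
  have "e \<notin> supp X" using assms point \<open>f \<noteq> e\<close> by blast
  then obtain Z where "Z \<in> C" "e \<in> supp Z" "supp Z \<subseteq> supp X' \<union> supp X - {f}"
    using strong_elimination[of X' X f e] assms X' by blast
  then show False using not_spanned[of Z] X' assms(3) by blast
qed

text \<open>Strong elimination of \<open>h\<close> keeps \<open>e\<close>, and the new circuit must
  still contain \<open>f\<close>, since otherwise \<open>H\<close> would span
  \<open>e\<close>.\<close>

lemma link_replace:
  assumes "link f X" "W \<in> C" "supp W \<subseteq> H" "h \<in> supp W" "h \<in> supp X"
  shows "\<exists>X'. link f X' \<and> supp X' \<subseteq> supp X \<union> supp W - {h}"
proof -
  note X = linkD[OF assms(1)]
  have "e \<notin> supp W" using assms point by blast
  then obtain Z where Z: "Z \<in> C" "e \<in> supp Z" "supp Z \<subseteq> supp X \<union> supp W - {h}"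
    using strong_elimination[of X W h e] X assms by blast
  then have "link f Z" using linkI[of Z f] X assms by blast
  then show ?thesis using Z by blast
qed

text \<open>Take a link with fewest elements outside \<open>T\<close>. A circuit inside
  \<open>T \<union> supp X\<close> has an element \<open>h\<close> outside \<open>T\<close>, and
  \<open>link_replace\<close> would trade \<open>h\<close> for elements of \<open>T\<close>.\<close>

lemma link_avoiding:
  assumes "f \<in> E - H" "f \<noteq> e" "T \<subseteq> H" "\<And>W. W \<in> C \<Longrightarrow> \<not> supp W \<subseteq> T"
  obtains X where "link f X" "\<And>W. W \<in> C \<Longrightarrow> supp W \<subseteq> H \<Longrightarrow> \<not> supp W \<subseteq> T \<union> supp X"
proof -
  obtain X where X: "link f X" and
      min: "\<And>X'. link f X' \<Longrightarrow> card (supp X - T) \<le> card (supp X' - T)"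
    using link_exists[OF assms(1,2)] ex_has_least_nat[of "link f" _ "\<lambda>X. card (supp X - T)"] by blast
  have "\<not> supp W \<subseteq> T \<union> supp X" if W: "W \<in> C" "supp W \<subseteq> H" for W
  proof
    assume sub: "supp W \<subseteq> T \<union> supp X"
    obtain h where h: "h \<in> supp W" "h \<notin> T" using assms(4)[OF W(1)] by blast
    then obtain X' where X': "link f X'" "supp X' \<subseteq> supp X \<union> supp W - {h}"
      using link_replace[OF X W h(1)] sub by blast
    have "card (supp X' - T) < card (supp X - T)"
      using X' h sub finite_supp[OF linkD(1)[OF X]] by (intro psubset_card_mono) auto
    then show False using min[OF X'(1)] by simp
  qed
  then show thesis using that X by blast
qed

text \<open>For a counterexample with smallest union of supports, the circuits in \<open>H\<close> inside that union
  contain the symmetric difference of the supports. Hence the two circuits obtained by eliminating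
  \<open>e\<close> and \<open>f\<close> agree up to sign, but their signs on the symmetric difference are incompatible.\<close>

lemma link_sign_unique:
  assumes "link f X" "link f X'" "e \<in> fst X" "e \<in> fst X'" "f \<in> fst X"
  shows "f \<notin> snd X'"
proof -
  \<comment> \<open>Both sign patterns at \<open>f\<close> are allowed, which makes
    \<open>bad\<close> symmetric, so minimality applies in either order.\<close>
  define bad where "bad X X' \<longleftrightarrow> link f X \<and> link f X' \<and> e \<in> fst X \<and> e \<in> fst X' \<and>
      (f \<in> fst X \<and> f \<in> snd X' \<or> f \<in> snd X \<and> f \<in> fst X')" for X X'
  have "\<not> bad X X'" for X X'
  proof (induction "card (supp X \<union> supp X')" arbitrary: X X' rule: less_induct)
    case less
    note IH = less.hyps
    have smaller: "\<not> bad P Q" if "supp P \<union> supp Q \<subseteq> supp X \<union> supp X' - {x}"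
      "x \<in> supp X \<union> supp X'" "bad X X'" for P Q x
    proof (rule IH)
      have "finite (supp X \<union> supp X')"
        using that(3) finite_supp by (auto simp: bad_def link_def)
      then show "card (supp P \<union> supp Q) < card (supp X \<union> supp X')"
        using that by (intro psubset_card_mono) auto
    qed
    have contains: "supp P - supp Q \<subseteq> supp W"
      if PQ: "bad P Q" "bad X X'" "supp P \<union> supp Q = supp X \<union> supp X'"
        and W: "W \<in> C" "supp W \<subseteq> H" "supp W \<subseteq> supp P \<union> supp Q" for P Q W
    proof (rule ccontr)
      assume "\<not> supp P - supp Q \<subseteq> supp W"
      then obtain g where g: "g \<in> supp P" "g \<notin> supp Q" "g \<notin> supp W" by blast
      have l: "link f P" "link f Q" using PQ by (auto simp: bad_def)
      note P = linkD[OF l(1)] and Q = linkD[OF l(2)]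
      have "e \<notin> supp W" using W point by blast
      then obtain h where h: "h \<in> supp W" "h \<notin> supp P"
        using supp_eqI[OF W(1) P(1)] P by blast
      then have "h \<in> supp Q" using W by blast
      then obtain R where R: "link f R" "supp R \<subseteq> supp Q \<union> supp W - {h}"
        using link_replace[OF l(2) W(1,2) h(1)] by blast
      obtain R' where R': "link f R'" "supp R' = supp R" "e \<in> fst R'"
        using circuit_with_sign[of R e] linkD[OF R(1)] R(1) by (metis link_def)
      \<comment> \<open>\<open>P\<close> and \<open>Q\<close> have opposite signs at
        \<open>f\<close>, so \<open>R'\<close> disagrees with one of them. Both new pairs have a
        smaller union, without \<open>g\<close> or without \<open>h\<close>.\<close>
      have "\<not> bad R' Q"
        by (rule smaller[of _ _ g]) (use R R' PQ(2,3) g W in blast)+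
      moreover have "\<not> bad P R'"
        by (rule smaller[of _ _ h]) (use R R' PQ(2,3) h W in blast)+
      moreover have "f \<in> fst R' \<or> f \<in> snd R'" using linkD(6)[OF R'(1)] by (simp add: in_supp_iff)
      ultimately show False using PQ(1) R'(1,3) unfolding bad_def by blast
    qed
    show ?case
    proof
      assume b: "bad X X'"
      obtain P Q where PQ: "bad P Q" "f \<in> fst P" "f \<in> snd Q" "supp P \<union> supp Q = supp X \<union> supp X'"
      proof (cases "f \<in> fst X \<and> f \<in> snd X'")
        case False
        then show thesis using that[of X' X] b by (auto simp: bad_def)
      qed (use that[of X X'] b in auto)
      then have QP: "bad Q P" by (auto simp: bad_def)
      have l: "link f P" "link f Q" and e: "e \<in> fst P" "e \<in> fst Q" using PQ by (auto simp: bad_def)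
      note P = linkD[OF l(1)] and Q = linkD[OF l(2)]
      note dP = signs_disjoint[OF P(1)] and dQ = signs_disjoint[OF Q(1)]
      have cont: "supp P - supp Q \<subseteq> supp W" "supp Q - supp P \<subseteq> supp W"
        if "W \<in> C" "supp W \<subseteq> H" "supp W \<subseteq> supp P \<union> supp Q" for W
        using contains[OF PQ(1) b PQ(4) that] contains[OF QP b _ that(1,2)] PQ(4) that(3)
        by (auto simp: Un_commute)
      have "P \<noteq> Q" "P \<noteq> opp Q" using PQ(2,3) dQ dP e by auto
      then obtain g h where g: "g \<in> supp P" "g \<notin> supp Q" and h: "h \<in> supp Q" "h \<notin> supp P"
        using incomparable[of P Q] incomparable[of Q P] P(1) Q(1) by (metis opp_opp subsetI)
      \<comment> \<open>After the elimination at most one of \<open>e\<close> and \<open>f\<close>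
        can lie outside \<open>H\<close>, and a circuit never leaves \<open>H\<close> in a single
        element.\<close>
      have into_H: "supp Z \<subseteq> H" if "Z \<in> C" "supp Z \<subseteq> supp P \<union> supp Q - {x}" "x \<in> {e, f}" for Z x
      proof -
        have "supp Z \<subseteq> insert e H \<or> supp Z \<subseteq> insert f H" using that P(7) Q(7) by blast
        then show ?thesis
          using no_single_intersection[OF that(1), of e] no_single_intersection[OF that(1), of f]
            P(4) point by blast
      qed
      obtain Z where Z: "Z \<in> C" "fst Z \<subseteq> (fst P \<union> fst Q) - {f}" "snd Z \<subseteq> (snd P \<union> snd Q) - {f}"
        using elimination[of P Q f] P(1) Q(1) PQ(2,3) \<open>P \<noteq> opp Q\<close> by blast
      obtain Z' where Z': "Z' \<in> C" "fst Z' \<subseteq> (fst P \<union> snd Q) - {e}" "snd Z' \<subseteq> (snd P \<union> fst Q) - {e}"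
        using elimination[of P "opp Q" e] P(1) symmetric[OF Q(1)] e \<open>P \<noteq> Q\<close> by auto
      have sZ: "supp Z \<subseteq> supp P \<union> supp Q - {f}" using Z unfolding supp_def by blast
      have sZ': "supp Z' \<subseteq> supp P \<union> supp Q - {e}" using Z' unfolding supp_def by blast
      have H: "supp Z \<subseteq> H" "supp Z' \<subseteq> H"
        using into_H[OF Z(1) sZ] into_H[OF Z'(1) sZ'] by auto
      have gh: "g \<in> supp Z" "g \<in> supp Z'" "h \<in> supp Z" "h \<in> supp Z'"
        using cont[OF Z(1) H(1)] cont[OF Z'(1) H(2)] sZ sZ' g h by blast+
      show False
      proof (cases "supp Z = supp Z'")
        \<comment> \<open>At \<open>g\<close> both circuits carry the sign of \<open>P\<close>, so
          they cannot be opposite. At \<open>h\<close> one carries the sign of \<open>Q\<close> and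
          the other that of \<open>opp Q\<close>, so they cannot be equal.\<close>
        case True
        then have "Z = Z' \<or> Z = opp Z'" using incomparable[OF Z(1) Z'(1)] by simp
        then show False
          using gh g h Z(2,3) Z'(2,3) dP dQ signs_disjoint[OF Z(1)]
          unfolding in_supp_iff by (elim disjE) auto
      next
        \<comment> \<open>Eliminating \<open>g\<close> produces a circuit inside \<open>H\<close>
          that misses \<open>g\<close>, contrary to \<open>cont\<close>.\<close>
        case False
        then obtain W where W: "W \<in> C" "supp W \<subseteq> supp Z \<union> supp Z' - {g}"
          using weak_elimination[OF Z(1) Z'(1)] gh by blast
        then show False using cont(1)[of W] H sZ sZ' g by blast
      qed
    qed
  qed
  from this[of X X'] show ?thesis using assms unfolding bad_def by blast
qed

text \<open>A link meets the complement of \<open>H\<close> only in \<open>e\<close> and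
  \<open>f\<close>. With \<open>e\<close> taken positive, orthogonality forces at \<open>f\<close>
  the sign opposite to that of a link positive at \<open>e\<close>.\<close>

definition cosign :: "'a signed" where
  "cosign = (insert e {f. \<exists>X. link f X \<and> e \<in> fst X \<and> f \<in> snd X},
             {f. \<exists>X. link f X \<and> e \<in> fst X \<and> f \<in> fst X})"

lemma point_in_cosign: "e \<in> fst cosign"
  by (simp add: cosign_def)

lemma link_signed:
  assumes "f \<in> E - H" "f \<noteq> e"
  shows "\<exists>X. link f X \<and> e \<in> fst X"
  using link_exists[OF assms] linkD(5) link_opp by (metis fst_opp in_supp_iff)

lemma supp_cosign: "supp cosign = E - H"
proof
  show "supp cosign \<subseteq> E - H" using linkD point by (auto simp: cosign_def supp_def)
  show "E - H \<subseteq> supp cosign"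
    using link_signed linkD(6) unfolding cosign_def supp_def by fastforce
qed

lemma signed_on_cosign: "signed_on E cosign"
  unfolding signed_on_def supp_cosign
  using link_sign_unique linkD(2) by (fastforce simp: cosign_def)

text \<open>Eliminating \<open>f\<close> against a link positive at \<open>e\<close> and opposite to
  \<open>X\<close> at \<open>f\<close> preserves agreement with \<open>cosign\<close> and leaves
  fewer elements outside \<open>H\<close>, so by induction the result lies in \<open>H\<close>. The
  link is chosen so that no circuit in \<open>H\<close> fits into the available union.\<close>

lemma conformal_imp_in_hyperplane:
  assumes "X \<in> C" "fst X \<inter> snd cosign = {}" "snd X \<inter> fst cosign = {}"
  shows "supp X \<subseteq> H"
  using assms
proof (induction "card (supp X - H - {e})" arbitrary: X rule: less_induct)
  case less
  show ?case
  proof (rule ccontr)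
    assume "\<not> supp X \<subseteq> H"
    then obtain f where f: "f \<in> supp X" "f \<notin> H" "f \<noteq> e"
      using not_spanned[OF less.prems(1)] by blast
    have fE: "f \<in> E" using f supp_subset_ground[OF less.prems(1)] by blast
    have "\<not> supp W \<subseteq> supp X \<inter> H" if "W \<in> C" for W
      using supp_eqI[OF that less.prems(1)] f by blast
    then obtain X0 where X0: "link f X0"
        and indep: "\<And>W. W \<in> C \<Longrightarrow> supp W \<subseteq> H \<Longrightarrow> \<not> supp W \<subseteq> supp X \<inter> H \<union> supp X0"
      using link_avoiding[of f "supp X \<inter> H"] f fE by blast
    obtain X1 where X1: "link f X1" "e \<in> fst X1" "supp X1 = supp X0"
      using circuit_with_sign[of X0 e] linkD[OF X0] X0 by (metis link_def)
    note l = linkD[OF X1(1)]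
    have e: "e \<notin> snd X" "e \<notin> snd X1"
      using point_in_cosign less.prems signs_disjoint[OF l(1) X1(2)] by auto
    have ne: "X \<noteq> opp X1" "X1 \<noteq> opp X" using e X1(2) by auto
    obtain Z where Z: "Z \<in> C" "fst Z \<subseteq> fst X \<union> fst X1 - {f}" "snd Z \<subseteq> snd X \<union> snd X1 - {f}"
    proof (cases "f \<in> fst X1")
      case True
      then have "f \<in> snd cosign" using X1 unfolding cosign_def snd_conv by blast
      then have "f \<in> snd X" using f less.prems by (auto simp: in_supp_iff)
      then show thesis using elimination[of X1 X f] that True l(1) less.prems(1) ne
        by (metis IntI Un_commute)
    next
      case False
      then have fs: "f \<in> snd X1" using l by (simp add: in_supp_iff)
      then have "f \<in> fst cosign" using X1 unfolding cosign_def fst_conv by blast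
      then have "f \<in> fst X" using f less.prems by (auto simp: in_supp_iff)
      then show thesis using elimination[of X X1 f] that fs l(1) less.prems(1) ne
        by (metis IntI)
    qed
    have sZ: "supp Z \<subseteq> supp X \<union> supp X1 - {f}" using Z unfolding supp_def by blast
    have "fst X1 - {f} \<subseteq> insert e H" "snd X1 - {f} \<subseteq> H"
      using l(7) e unfolding supp_def by blast+
    moreover have "snd cosign \<inter> insert e H = {}" "fst cosign \<inter> H = {}"
      using signed_on_cosign supp_cosign point_in_cosign point
      unfolding signed_on_def supp_def by blast+
    ultimately have conf: "fst Z \<inter> snd cosign = {}" "snd Z \<inter> fst cosign = {}"
      using Z less.prems by blast+
    have "card (supp Z - H - {e}) < card (supp X - H - {e})"
      using sZ l(7) f finite_supp[OF less.prems(1)] by (intro psubset_card_mono) auto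
    then have "supp Z \<subseteq> H" using less.hyps Z(1) conf by blast
    then show False using indep[OF Z(1)] sZ X1(3) by blast
  qed
qed

text \<open>If orthogonality failed, \<open>X\<close> or \<open>opp X\<close> would agree with
  \<open>cosign\<close> everywhere and yet meet its support.\<close>

lemma orthogonal_cosign:
  assumes "X \<in> C"
  shows "orthogonal X cosign"
proof -
  have "supp X \<inter> supp cosign = {}"
    if "fst X \<inter> snd cosign = {} \<and> snd X \<inter> fst cosign = {} \<or>
        snd X \<inter> snd cosign = {} \<and> fst X \<inter> fst cosign = {}"
    using conformal_imp_in_hyperplane[of X] conformal_imp_in_hyperplane[of "opp X"] that
      assms symmetric[OF assms] supp_cosign by auto
  then show ?thesis unfolding orthogonal_def by blast
qed

text \<open>Let \<open>B\<close> be a largest independent subset of \<open>H\<close>. Adding any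
  \<open>f\<close> outside \<open>H\<close> gives a basis, so proper subsets of \<open>E - H\<close>
  are coindependent. \<open>E - H\<close> itself is not, as a basis inside \<open>H\<close> could be
  enlarged by \<open>e\<close>.\<close>

lemma underlying_cocircuit_complement: "underlying_cocircuit E C (E - H)"
proof -
  let ?ind = "\<lambda>I. I \<subseteq> H \<and> (\<forall>W\<in>C. \<not> supp W \<subseteq> I)"
  have fH: "finite H" using hyperplane_subset finite_ground finite_subset by blast
  have "?ind {}" using nonempty by auto
  then have "\<exists>B. ?ind B \<and> (\<forall>I. ?ind I \<longrightarrow> card I \<le> card B)"
    using fH by (intro ex_has_greatest_nat[of ?ind "{}" card "Suc (card H)"])
      (auto simp: less_Suc_eq_le intro: card_mono)
  then obtain B where B: "?ind B" and max: "\<And>I. ?ind I \<Longrightarrow> card I \<le> card B" by blast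
  have B_eq: "I = B" if "?ind I" "B \<subseteq> I" for I
    using that max[OF that(1)] fH by (metis card_seteq finite_subset)
  have link_B: "\<exists>X. link f X \<and> supp X \<subseteq> {e, f} \<union> B" if f: "f \<in> E - H" "f \<noteq> e" for f
  proof -
    obtain X where X: "link f X"
        "\<And>W. W \<in> C \<Longrightarrow> supp W \<subseteq> H \<Longrightarrow> \<not> supp W \<subseteq> B \<union> supp X"
      using link_avoiding[OF f, of B] B by blast
    \<comment> \<open>\<open>B\<close> together with the trace of the link on \<open>H\<close> is
      independent, so maximality of \<open>B\<close> absorbs the trace.\<close>
    have "?ind (B \<union> (supp X \<inter> H))" using B X(2) by blast
    then have "B \<union> (supp X \<inter> H) = B" by (rule B_eq) blast
    then show ?thesis using X(1) linkD(7)[OF X(1)] by blast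
  qed
  have circuit_B: "\<exists>Z\<in>C. supp Z \<subseteq> {f, g} \<union> B" if fg: "f \<in> E - H" "g \<in> E - H" "f \<noteq> g" for f g
  proof (cases "e \<in> {f, g}")
    case True
    then obtain h where h: "{e, h} = {f, g}" "h \<in> E - H" "h \<noteq> e" using fg by blast
    then obtain X where "link h X" "supp X \<subseteq> {e, h} \<union> B" using link_B[of h] by blast
    then show ?thesis using linkD(1) h(1) by metis
  next
    case False
    then obtain X Y where X: "link f X" "supp X \<subseteq> {e, f} \<union> B" and Y: "link g Y" "supp Y \<subseteq> {e, g} \<union> B"
      using link_B fg by (metis insert_iff)
    have "f \<notin> supp Y" using linkD(7)[OF Y(1)] fg False by blast
    then obtain Z where "Z \<in> C" "supp Z \<subseteq> supp X \<union> supp Y - {e}"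
      using weak_elimination[of X Y e] linkD[OF X(1)] linkD[OF Y(1)] by blast
    then show ?thesis using X Y by blast
  qed
  have basis_insert: "basis E C (insert f B)" if f: "f \<in> E - H" for f
    unfolding basis_def
  proof (intro conjI allI impI)
    show "independent E C (insert f B)"
      unfolding independent_def
    proof (intro conjI ballI notI)
      show "insert f B \<subseteq> E" using f B hyperplane_subset by blast
      fix X assume X: "X \<in> C" "supp X \<subseteq> insert f B"
      then have "f \<notin> supp X" using no_single_intersection[of X f] f B by blast
      then show False using X B by blast
    qed
    fix I assume I: "independent E C I" "insert f B \<subseteq> I"
    have "x \<in> insert f B" if x: "x \<in> I" for x
    proof (cases "x \<in> H")
      case True
      then have "?ind (insert x B)" using I x B unfolding independent_def by blast
      then have "insert x B = B" by (rule B_eq) blast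
      then show ?thesis by blast
    next
      case False
      show ?thesis
      proof (rule ccontr)
        assume "x \<notin> insert f B"
        then obtain Z where "Z \<in> C" "supp Z \<subseteq> {f, x} \<union> B"
          using circuit_B[of f x] False f x I unfolding independent_def by blast
        then show False using I x unfolding independent_def by blast
      qed
    qed
    then show "I = insert f B" using I by blast
  qed
  have "\<not> coindependent E C (E - H)"
  proof
    assume "coindependent E C (E - H)"
    then obtain B0 where B0: "basis E C B0" "E - H \<subseteq> E - B0" by (auto simp: coindependent_def)
    then have sub: "B0 \<subseteq> H" unfolding basis_def independent_def by blast
    have "insert e B0 \<noteq> B0" using sub point by blast
    then have "\<not> independent E C (insert e B0)" using B0(1) unfolding basis_def by blast
    then obtain X where X: "X \<in> C" "supp X \<subseteq> insert e B0"
      using sub point hyperplane_subset unfolding independent_def by blast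
    moreover have "\<not> supp X \<subseteq> B0" using X(1) B0(1) unfolding basis_def independent_def by blast
    ultimately show False using not_spanned[OF X(1)] sub by blast
  qed
  moreover have "coindependent E C D" if D: "D \<subset> E - H" for D
  proof -
    obtain f where "f \<in> E - H" "f \<notin> D" using D by blast
    then show ?thesis using basis_insert[of f] B D unfolding coindependent_def by blast
  qed
  ultimately show ?thesis unfolding underlying_cocircuit_def by blast
qed

lemma cosign_cocircuit: "cosign \<in> cocircuits E C"
  unfolding cocircuits_def
  using signed_on_cosign underlying_cocircuit_complement orthogonal_cosign supp_cosign by simp

end

section \<open>Painting\<close>

context oriented_matroid
begin

text \<open>\<open>G\<close> does not span \<open>e\<close>, so it extends to a maximal set with
  this property. That set is a hyperplane, and its \<open>cosign\<close> is the cocircuit.\<close>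

lemma cocircuit_exists:
  assumes "G \<subseteq> E" "e \<in> E - G" and none: "\<And>X. X \<in> C \<Longrightarrow> e \<in> supp X \<Longrightarrow> \<not> supp X \<subseteq> insert e G"
  shows "\<exists>Y\<in>cocircuits E C. e \<in> fst Y \<and> supp Y \<inter> G = {}"
proof -
  let ?P = "\<lambda>H. G \<subseteq> H \<and> H \<subseteq> E - {e} \<and> (\<forall>X\<in>C. e \<in> supp X \<longrightarrow> \<not> supp X \<subseteq> insert e H)"
  have "?P G" using assms by blast
  then have "\<exists>H. ?P H \<and> (\<forall>I. ?P I \<longrightarrow> card I \<le> card H)"
    using finite_ground
    by (intro ex_has_greatest_nat[of ?P G card "Suc (card E)"])
      (auto simp: less_Suc_eq_le intro!: card_mono)
  then obtain H where H: "?P H" and max: "\<And>I. ?P I \<Longrightarrow> card I \<le> card H" by blast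
  have fH: "finite H" using H finite_ground finite_subset by blast
  interpret pointed_hyperplane E C H e
  proof
    show "\<exists>X\<in>C. e \<in> supp X \<and> supp X \<subseteq> {e, f} \<union> H" if f: "f \<in> E - H" "f \<noteq> e" for f
    proof (rule ccontr)
      assume no: "\<not> ?thesis"
      have "?P (insert f H)"
        using H f no by auto
      then show False using max[of "insert f H"] f fH by simp
    qed
  qed (use H assms in auto)
  show ?thesis using cosign_cocircuit point_in_cosign supp_cosign H by blast
qed

text \<open>Moving \<open>f \<in> B\<close> to the green set \<open>G\<close> yields a circuit negative at \<open>f\<close>, moving it to the red
  complement yields a cocircuit, and orthogonality makes this cocircuit positive at \<open>f\<close>.\<close>

lemma painting:
  assumes "B \<subseteq> E" "G \<subseteq> E" "B \<inter> G = {}" "e \<in> B"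
  shows "(\<exists>X\<in>C. e \<in> fst X \<and> snd X \<inter> B = {} \<and> supp X \<subseteq> B \<union> G) \<or>
         (\<exists>Y\<in>cocircuits E C. e \<in> fst Y \<and> snd Y \<inter> B = {} \<and> supp Y \<inter> G = {})"
  using assms
proof (induction "card B" arbitrary: B G rule: less_induct)
  case less
  note prems = less.prems
  have fB: "finite B" using prems finite_ground finite_subset by blast
  show ?case
  proof (cases "B = {e}")
    case True
    show ?thesis
    proof (cases "\<exists>X\<in>C. e \<in> supp X \<and> supp X \<subseteq> insert e G")
      case True
      then obtain X where "X \<in> C" "e \<in> fst X" "supp X \<subseteq> insert e G"
        using circuit_with_sign by metis
      then show ?thesis using \<open>B = {e}\<close> signs_disjoint[of X e] by auto
    next
      case False
      then obtain Y where Y: "Y \<in> cocircuits E C" "e \<in> fst Y" "supp Y \<inter> G = {}"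
        using cocircuit_exists[of G e] prems by blast
      then have "snd Y \<inter> B = {}" using \<open>B = {e}\<close> by (auto simp: cocircuits_def signed_on_def)
      then show ?thesis using Y by blast
    qed
  next
    case False
    then obtain f where f: "f \<in> B" "f \<noteq> e" using prems by blast
    have less_card: "card (B - {f}) < card B" using f fB by (meson card_Diff1_less)
    have sets: "B - {f} \<subseteq> E" "insert f G \<subseteq> E" "(B - {f}) \<inter> insert f G = {}"
        "(B - {f}) \<inter> G = {}" "e \<in> B - {f}"
      using prems f by auto
    show ?thesis
    proof (rule ccontr)
      assume neg: "\<not> ?thesis"
      have "\<not> (\<exists>Y\<in>cocircuits E C. e \<in> fst Y \<and> snd Y \<inter> (B - {f}) = {} \<and> supp Y \<inter> insert f G = {})"
        using neg by (auto simp: supp_def)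
      then obtain X where X: "X \<in> C" "e \<in> fst X" "snd X \<inter> (B - {f}) = {}"
          "supp X \<subseteq> (B - {f}) \<union> insert f G"
        using less.hyps[OF less_card sets(1-3,5)] by blast
      have "\<not> (\<exists>X\<in>C. e \<in> fst X \<and> snd X \<inter> (B - {f}) = {} \<and> supp X \<subseteq> (B - {f}) \<union> G)"
        using neg prems f unfolding supp_def by blast
      then obtain Y where Y: "Y \<in> cocircuits E C" "e \<in> fst Y" "snd Y \<inter> (B - {f}) = {}"
          "supp Y \<inter> G = {}"
        using less.hyps[OF less_card sets(1) \<open>G \<subseteq> E\<close> sets(4,5)] by blast
      have fX: "f \<in> snd X" using neg X f by blast
      have fY: "f \<in> snd Y" using neg Y by blast
      have "f \<notin> fst X" using signs_disjoint[OF X(1)] fX by blast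
      moreover have "f \<notin> fst Y" using Y(1) fY by (auto simp: cocircuits_def signed_on_def)
      moreover have "orthogonal X Y" using X(1) Y(1) by (simp add: cocircuits_def)
      \<comment> \<open>The supports meet only in \<open>B\<close>, where both signed sets are
        negative at \<open>f\<close> and nonnegative elsewhere. They share \<open>e\<close> but
        never have opposite signs.\<close>
      ultimately show False
        using X(2-4) Y(2-4) unfolding orthogonal_def supp_def by blast
    qed
  qed
qed

end

section \<open>Reorientation\<close>

lemma reorient_signed_invol [simp]: "reorient_signed A (reorient_signed A X) = X"
  by (cases X) (auto simp: reorient_signed_def)

lemma supp_reorient_signed [simp]: "supp (reorient_signed A X) = supp X"
  by (auto simp: reorient_signed_def supp_def)

lemma opp_reorient_signed: "opp (reorient_signed A X) = reorient_signed A (opp X)"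
  by (simp add: reorient_signed_def opp_def)

lemma signed_on_reorient_signed [simp]: "signed_on E (reorient_signed A X) \<longleftrightarrow> signed_on E X"
  by (auto simp: signed_on_def reorient_signed_def supp_def)

lemma orthogonal_reorient_signed [simp]:
  "orthogonal (reorient_signed A X) (reorient_signed A Y) \<longleftrightarrow> orthogonal X Y"
  unfolding orthogonal_def supp_reorient_signed by (auto simp: reorient_signed_def)

lemma in_reorient_iff: "X \<in> reorient A C \<longleftrightarrow> reorient_signed A X \<in> C"
  unfolding reorient_def by (metis image_iff reorient_signed_invol)

lemma underlying_cocircuit_reorient [simp]:
  "underlying_cocircuit E (reorient A C) D \<longleftrightarrow> underlying_cocircuit E C D"
proof -
  have "independent E (reorient A C) = independent E C"
    by (simp add: independent_def reorient_def fun_eq_iff)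
  then show ?thesis
    by (simp add: underlying_cocircuit_def coindependent_def basis_def)
qed

lemma cocircuits_reorient: "cocircuits E (reorient A C) = reorient A (cocircuits E C)"
proof -
  have "(\<forall>X\<in>reorient A C. orthogonal X Y) \<longleftrightarrow> (\<forall>X\<in>C. orthogonal X (reorient_signed A Y))" for Y
    unfolding reorient_def ball_simps
    by (metis orthogonal_reorient_signed reorient_signed_invol)
  then show ?thesis by (auto simp: cocircuits_def in_reorient_iff)
qed

lemma oriented_matroid_reorient:
  assumes "oriented_matroid E C"
  shows "oriented_matroid E (reorient A C)"
proof -
  interpret oriented_matroid E C by fact
  show ?thesis
  proof
    fix X Y assume X: "X \<in> reorient A C"
    show "signed_on E X"
      using X signed_circuits[of "reorient_signed A X"] by (simp add: in_reorient_iff)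
    show "supp X \<noteq> {}"
      using X nonempty[of "reorient_signed A X"] by (simp add: in_reorient_iff)
    show "opp X \<in> reorient A C"
      using X symmetric by (simp add: in_reorient_iff flip: opp_reorient_signed)
    assume Y: "Y \<in> reorient A C"
    show "X = Y \<or> X = opp Y" if "supp X \<subseteq> supp Y"
      using incomparable[of "reorient_signed A X" "reorient_signed A Y"] X Y that
      by (metis in_reorient_iff opp_reorient_signed reorient_signed_invol supp_reorient_signed)
    fix e assume ne: "X \<noteq> opp Y" and e: "e \<in> fst X \<inter> snd Y"
    let ?X = "reorient_signed A X" and ?Y = "reorient_signed A Y"
    have XY: "?X \<in> C" "?Y \<in> C" using X Y by (auto simp: in_reorient_iff)
    have ne': "?X \<noteq> opp ?Y" "?Y \<noteq> opp ?X"
      using ne by (metis opp_opp opp_reorient_signed reorient_signed_invol)+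
    \<comment> \<open>For \<open>e\<close> in \<open>A\<close> both signs flip, so the two circuits
      exchange roles.\<close>
    have "e \<in> fst ?X \<inter> snd ?Y \<or> e \<in> fst ?Y \<inter> snd ?X"
      using e by (auto simp: reorient_signed_def)
    then obtain Z where Z: "Z \<in> C" "fst Z \<subseteq> (fst ?X \<union> fst ?Y) - {e}" "snd Z \<subseteq> (snd ?X \<union> snd ?Y) - {e}"
      using elimination[of ?X ?Y e] elimination[of ?Y ?X e] XY ne' by (metis Un_commute)
    show "\<exists>Z\<in>reorient A C. fst Z \<subseteq> (fst X \<union> fst Y) - {e} \<and> snd Z \<subseteq> (snd X \<union> snd Y) - {e}"
    proof (intro bexI conjI)
      show "reorient_signed A Z \<in> reorient A C" using Z(1) by (simp add: reorient_def)
      show "fst (reorient_signed A Z) \<subseteq> (fst X \<union> fst Y) - {e}"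
        "snd (reorient_signed A Z) \<subseteq> (snd X \<union> snd Y) - {e}"
        using Z(2,3) by (auto simp: reorient_signed_def)
    qed
  qed (rule finite_ground)
qed

section \<open>Unions of positive circuits\<close>

text \<open>The bound is an arbitrary set rather than an index into the active elements, so flats
  can be compared across a reorientation before the active elements are known to agree.\<close>

definition flat :: "'a signed set \<Rightarrow> 'a set \<Rightarrow> 'a set" where
  "flat C S = \<Union> {supp X | X. X \<in> C \<and> positive X \<and> supp X \<subseteq> S}"

text \<open>The only facts about the pair of circuits and cocircuits that the theorem needs; they are
  symmetric in the two families.\<close>

locale signed_pair =
  fixes E :: "'a::linorder set" and C D :: "'a signed set"
  assumes finite_E: "finite E"
    and signed_C: "X \<in> C \<Longrightarrow> signed_on E X \<and> supp X \<noteq> {}"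
    and signed_D: "Y \<in> D \<Longrightarrow> signed_on E Y \<and> supp Y \<noteq> {}"
    and orth: "X \<in> C \<Longrightarrow> Y \<in> D \<Longrightarrow> orthogonal X Y"
    and paint_C: "B \<subseteq> E \<Longrightarrow> e \<in> B \<Longrightarrow> e \<notin> flat C B \<Longrightarrow> \<exists>Y\<in>D. e \<in> fst Y \<and> snd Y \<inter> B = {}"
    and paint_D: "B \<subseteq> E \<Longrightarrow> e \<in> B \<Longrightarrow> e \<notin> flat D B \<Longrightarrow> \<exists>X\<in>C. e \<in> fst X \<and> snd X \<inter> B = {}"

lemma orthogonal_commute: "orthogonal X Y \<longleftrightarrow> orthogonal Y X"
  unfolding orthogonal_def by (auto simp: Int_commute)

lemma signed_pair_swap:
  assumes "signed_pair E C D"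
  shows "signed_pair E D C"
proof -
  interpret signed_pair E C D by fact
  show ?thesis
    by unfold_locales
      (use finite_E signed_C signed_D orth orthogonal_commute paint_C paint_D in blast)+
qed

text \<open>The two painting rules are \<open>painting\<close> with \<open>G\<close> empty and with
  \<open>G\<close> the complement of \<open>B\<close>. In each case one alternative is a positive
  signed set inside \<open>B\<close>.\<close>

lemma signed_pair_cocircuits:
  fixes E :: "'a::linorder set"
  assumes "oriented_matroid E C"
  shows "signed_pair E C (cocircuits E C)"
proof -
  interpret oriented_matroid E C by fact
  have flatI: "e \<in> flat K B" if "X \<in> K" "e \<in> fst X" "snd X \<inter> B = {}" "supp X \<subseteq> B" for K X e and B :: "'a set"
  proof -
    have "positive X" "e \<in> supp X" using that unfolding positive_def supp_def by blast+
    then show ?thesis using that unfolding flat_def by blast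
  qed
  show ?thesis
  proof
    show "finite E" by (rule finite_ground)
    show "signed_on E X \<and> supp X \<noteq> {}" if "X \<in> C" for X
      using that signed_circuits nonempty by blast
    show "orthogonal X Y" if "X \<in> C" "Y \<in> cocircuits E C" for X Y
      using that by (simp add: cocircuits_def)
    show "signed_on E Y \<and> supp Y \<noteq> {}" if Y: "Y \<in> cocircuits E C" for Y
    proof -
      \<comment> \<open>A largest independent set is a basis, so the empty set is coindependent and
        hence no cocircuit.\<close>
      have "\<exists>B. independent E C B \<and> (\<forall>I. independent E C I \<longrightarrow> card I \<le> card B)"
        using finite_ground nonempty
        by (intro ex_has_greatest_nat[of _ "{}" card "Suc (card E)"])
          (auto simp: independent_def less_Suc_eq_le intro: card_mono)
      then obtain B where B: "independent E C B" "\<And>I. independent E C I \<Longrightarrow> card I \<le> card B" by blast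
      have "basis E C B"
        unfolding basis_def using B finite_ground
        by (metis card_seteq finite_subset independent_def)
      then have "coindependent E C {}" by (auto simp: coindependent_def)
      then show ?thesis using Y by (auto simp: cocircuits_def underlying_cocircuit_def)
    qed
    fix B e assume B: "B \<subseteq> E" "e \<in> B"
    show "\<exists>Y\<in>cocircuits E C. e \<in> fst Y \<and> snd Y \<inter> B = {}" if "e \<notin> flat C B"
      using painting[of B "{}" e] B flatI[of _ C e B] that by auto
    show "\<exists>X\<in>C. e \<in> fst X \<and> snd X \<inter> B = {}" if "e \<notin> flat (cocircuits E C) B"
    proof (rule ccontr)
      assume "\<not> ?thesis"
      then obtain Y where Y: "Y \<in> cocircuits E C" "e \<in> fst Y" "snd Y \<inter> B = {}" "supp Y \<inter> (E - B) = {}"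
        using painting[of B "E - B" e] B by auto
      then have "supp Y \<subseteq> B" by (auto simp: cocircuits_def signed_on_def)
      then show False using flatI[of Y _ e B] Y that by blast
    qed
  qed
qed

definition part :: "'a::linorder signed set \<Rightarrow> 'a \<Rightarrow> 'a set" where
  "part C b = flat C {b..} - flat C {b<..}"

lemma flat_mono: "S \<subseteq> T \<Longrightarrow> flat C S \<subseteq> flat C T"
  unfolding flat_def by blast

lemma in_flatE:
  assumes "x \<in> flat C S"
  obtains X where "X \<in> C" "snd X = {}" "x \<in> fst X" "supp X \<subseteq> S" "supp X = fst X"
  using assms unfolding flat_def positive_def supp_def by auto

lemma flat_subset: "flat C S \<subseteq> S"
  unfolding flat_def by blast

lemma supp_subset_flat: "X \<in> C \<Longrightarrow> snd X = {} \<Longrightarrow> supp X \<subseteq> S \<Longrightarrow> supp X \<subseteq> flat C S"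
  unfolding flat_def positive_def by blast

context signed_pair
begin

lemma supp_C: "X \<in> C \<Longrightarrow> supp X \<subseteq> E" "X \<in> C \<Longrightarrow> finite (supp X)" "X \<in> C \<Longrightarrow> supp X \<noteq> {}"
  using signed_C[of X] finite_E by (auto simp: signed_on_def intro: finite_subset)

lemma flat_subset_E: "flat C S \<subseteq> E"
  using supp_C unfolding flat_def by blast

lemma flat_Int_E: "flat C (S \<inter> E) = flat C S"
proof -
  have "X \<in> C \<and> positive X \<and> supp X \<subseteq> S \<inter> E \<longleftrightarrow> X \<in> C \<and> positive X \<and> supp X \<subseteq> S" for X
    using supp_C(1)[of X] by blast
  then show ?thesis unfolding flat_def by (simp only:)
qed

lemma in_flat_atLeast:
  assumes "x \<in> flat C S"
  obtains c where "c \<in> S" "c \<in> E" "x \<in> flat C {c..}"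
proof -
  obtain X where X: "X \<in> C" "snd X = {}" "x \<in> fst X" "supp X \<subseteq> S" "supp X = fst X"
    using in_flatE[OF assms] by metis
  note s = supp_C[OF X(1)]
  have "Min (supp X) \<in> supp X" using s by simp
  moreover have "supp X \<subseteq> {Min (supp X)..}" using s by auto
  ultimately show thesis using that[of "Min (supp X)"] X supp_subset_flat[OF X(1,2)] s(1) by blast
qed

text \<open>A positive circuit and a positive cocircuit sharing an element would have no opposite
  signs on their intersection.\<close>

lemma flats_disjoint: "flat C S \<inter> flat D T = {}"
proof (rule ccontr)
  assume "\<not> ?thesis"
  then obtain x where x: "x \<in> flat C S" "x \<in> flat D T" by blast
  obtain X where X: "X \<in> C" "snd X = {}" "x \<in> fst X"
    using in_flatE[OF x(1)] by metis
  obtain Y where Y: "Y \<in> D" "snd Y = {}" "x \<in> fst Y"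
    using in_flatE[OF x(2)] by metis
  show False using orth[OF X(1) Y(1)] X Y by (auto simp: orthogonal_def supp_def)
qed

text \<open>Take the largest \<open>b\<close> in \<open>E\<close> with \<open>a \<le> b\<close>
  whose flat meets \<open>S\<close>. An element of \<open>S\<close> in \<open>flat C {b<..}\<close>
  would lie in \<open>flat C {c..}\<close> for some larger \<open>c\<close> in
  \<open>E\<close>.\<close>

lemma deepest_part:
  assumes "S \<inter> flat C {a..} \<noteq> {}"
  obtains b where "a \<le> b" "S \<inter> flat C {b..} \<noteq> {}" "S \<inter> flat C {b..} \<subseteq> part C b"
proof -
  define Q where "Q = {b\<in>E. a \<le> b \<and> S \<inter> flat C {b..} \<noteq> {}}"
  obtain x where x: "x \<in> S" "x \<in> flat C {a..}" using assms by blast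
  obtain c where "a \<le> c" "c \<in> E" "x \<in> flat C {c..}"
    using in_flat_atLeast[OF x(2)] by auto
  then have "c \<in> Q" using x(1) by (auto simp: Q_def)
  then have "Q \<noteq> {}" by blast
  moreover have "finite Q" using finite_E by (simp add: Q_def)
  ultimately have b: "Max Q \<in> Q" "\<And>c. c \<in> Q \<Longrightarrow> c \<le> Max Q" by auto
  have "S \<inter> flat C {Max Q<..} = {}"
  proof (rule ccontr)
    assume "\<not> ?thesis"
    then obtain y where y: "y \<in> S" "y \<in> flat C {Max Q<..}" by blast
    obtain c where c: "c > Max Q" "c \<in> E" "y \<in> flat C {c..}"
      using in_flat_atLeast[OF y(2)] by auto
    have "a \<le> c" using b(1) c(1) by (auto simp: Q_def)
    then have "c \<in> Q" using c y by (auto simp: Q_def)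
    then show False using b(2) c(1) by fastforce
  qed
  then show thesis using that[of "Max Q"] b(1) unfolding Q_def part_def by blast
qed

end

section \<open>Reorienting parts\<close>

locale reoriented_pair = signed_pair E C D for E :: "'a::linorder set" and C D +
  fixes A :: "'a set"
  assumes pair_reorient: "signed_pair E (reorient A C) (reorient A D)"
    and part_C: "part C b \<subseteq> A \<or> part C b \<inter> A = {}"
    and part_D: "part D b \<subseteq> A \<or> part D b \<inter> A = {}"

lemma reoriented_pair_swap:
  assumes "reoriented_pair E C D A"
  shows "reoriented_pair E D C A"
proof -
  interpret reoriented_pair E C D A by fact
  interpret S: signed_pair E D C by (rule signed_pair_swap) unfold_locales
  show ?thesis
    by (intro reoriented_pair.intro reoriented_pair_axioms.intro S.signed_pair_axioms
        signed_pair_swap[OF pair_reorient] part_C part_D)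
qed

context reoriented_pair
begin

text \<open>A cocircuit that is positive on \<open>{a..}\<close> after reorientation has constant sign on the deepest
  part that it meets, where it contradicts orthogonality to a positive circuit.\<close>

lemma flat_subset_flat_reorient: "flat C {a..} \<subseteq> flat (reorient A C) {a..}"
proof
  fix e assume e: "e \<in> flat C {a..}"
  interpret R: signed_pair E "reorient A C" "reorient A D" by (rule pair_reorient)
  show "e \<in> flat (reorient A C) {a..}"
  proof (rule ccontr)
    assume "e \<notin> flat (reorient A C) {a..}"
    then have "e \<notin> flat (reorient A C) ({a..} \<inter> E)" by (simp add: R.flat_Int_E)
    then obtain Y' where "Y' \<in> reorient A D" "e \<in> fst Y'" "snd Y' \<inter> ({a..} \<inter> E) = {}"
      using R.paint_C[of "{a..} \<inter> E" e] e flat_subset[of C "{a..}"] flat_subset_E[of "{a..}"] by blast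
    then obtain Y where Y: "Y \<in> D" "e \<in> fst (reorient_signed A Y)"
        "snd (reorient_signed A Y) \<inter> ({a..} \<inter> E) = {}"
      by (auto simp: reorient_def)
    have "e \<in> supp Y" using Y(2) by (metis in_supp_iff supp_reorient_signed)
    then obtain b where b: "a \<le> b" "supp Y \<inter> flat C {b..} \<noteq> {}" "supp Y \<inter> flat C {b..} \<subseteq> part C b"
      using deepest_part[of "supp Y" a] e by blast
    then obtain x where x: "x \<in> supp Y" "x \<in> flat C {b..}" by blast
    obtain X where X: "X \<in> C" "snd X = {}" "x \<in> fst X" "supp X \<subseteq> {b..}" "supp X = fst X"
      using in_flatE[OF x(2)] by metis
    have sub: "supp X \<subseteq> flat C {b..}" using supp_subset_flat X by blast
    have "supp X \<subseteq> {a..} \<inter> E" using X(4) b(1) supp_C[OF X(1)] by fastforce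
    then have neg: "snd (reorient_signed A Y) \<inter> supp X = {}" using Y(3) by blast
    have XY: "supp X \<inter> supp Y \<subseteq> A \<or> supp X \<inter> supp Y \<inter> A = {}"
      using part_C[of b] b(3) sub by blast
    \<comment> \<open>On \<open>supp X\<close> the reoriented \<open>Y\<close> is nonnegative, and
      the common support is flipped entirely or not at all, so \<open>Y\<close> has constant sign
      there.\<close>
    have "fst X \<inter> snd Y = {} \<or> fst X \<inter> fst Y = {}"
      using XY neg X(5) by (auto simp: reorient_signed_def supp_def)
    then show False
      using orth[OF X(1) Y(1)] X x(1) by (auto simp: orthogonal_def)
  qed
qed

text \<open>A new positive circuit \<open>X\<close> has constant sign on the outermost part that it meets. If that
  part is dual, \<open>X\<close> contradicts a positive cocircuit; otherwise the part comes from some \<open>b < a\<close>, and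
  \<open>X\<close> contradicts a cocircuit that is positive above \<open>b\<close>.\<close>

lemma flat_reorient_subset_flat: "flat (reorient A C) {a..} \<subseteq> flat C {a..}"
proof
  fix e assume "e \<in> flat (reorient A C) {a..}"
  then obtain X' where X': "X' \<in> reorient A C" "snd X' = {}" "e \<in> fst X'" "supp X' \<subseteq> {a..}"
    using in_flatE by metis
  define X where "X = reorient_signed A X'"
  have XC: "X \<in> C" using X'(1) by (simp add: X_def in_reorient_iff)
  have sX: "supp X \<subseteq> {a..}" "e \<in> supp X" using X' by (auto simp: X_def in_supp_iff[of e X'])
  have fst_X: "fst X \<inter> A = {}" and snd_X: "snd X \<subseteq> A"
    using X'(2) by (auto simp: X_def reorient_signed_def)
  note XE = supp_C(1)[OF XC]
  interpret S: signed_pair E D C by (rule signed_pair_swap) unfold_locales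
  \<comment> \<open>\<open>{Min E..}\<close> contains \<open>E\<close>, so this flat is the union of
    all positive cocircuits.\<close>
  have no_dual: "supp X \<inter> flat D {Min E..} = {}"
  proof (rule ccontr)
    assume "supp X \<inter> flat D {Min E..} \<noteq> {}"
    then obtain b where "Min E \<le> b" and
        b: "supp X \<inter> flat D {b..} \<noteq> {}" "supp X \<inter> flat D {b..} \<subseteq> part D b"
      by (rule S.deepest_part)
    then obtain x where x: "x \<in> supp X" "x \<in> flat D {b..}" by blast
    obtain Y where Y: "Y \<in> D" "snd Y = {}" "x \<in> fst Y" "supp Y \<subseteq> {b..}" "supp Y = fst Y"
      using in_flatE[OF x(2)] by metis
    have "supp Y \<subseteq> flat D {b..}" using supp_subset_flat Y by blast
    then have "supp X \<inter> supp Y \<subseteq> A \<or> supp X \<inter> supp Y \<inter> A = {}"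
      using part_D[of b] b(2) by blast
    \<comment> \<open>\<open>X\<close> is positive off \<open>A\<close> and negative on
      \<open>A\<close>, hence of constant sign on the common support.\<close>
    then have "fst X \<inter> fst Y = {} \<or> snd X \<inter> fst Y = {}"
      using fst_X snd_X Y(5) by (auto simp: supp_def)
    then show False using orth[OF XC Y(1)] Y x(1) by (auto simp: orthogonal_def)
  qed
  have E_Min: "E \<subseteq> {Min E..}" using finite_E by auto
  \<comment> \<open>By painting on all of \<open>E\<close>, an element of \<open>X\<close> in no
    positive circuit would lie in a positive cocircuit.\<close>
  have in_cyclic: "supp X \<subseteq> flat C {Min E..}"
  proof (rule ccontr)
    assume "\<not> ?thesis"
    then obtain x where x: "x \<in> supp X" "x \<notin> flat C {Min E..}" by blast
    then have "x \<notin> flat C E" using flat_mono[OF E_Min, of C] by blast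
    then obtain Y where Y: "Y \<in> D" "x \<in> fst Y" "snd Y \<inter> E = {}"
      using paint_C[of E x] x XE by blast
    have "supp Y \<subseteq> E" using S.supp_C(1)[OF Y(1)] .
    then have "snd Y = {}" using Y(3) unfolding supp_def by blast
    then have "supp Y \<subseteq> flat D {Min E..}"
      using supp_subset_flat[OF Y(1)] \<open>supp Y \<subseteq> E\<close> E_Min by blast
    then show False using no_dual x(1) Y(2) unfolding supp_def by blast
  qed
  show "e \<in> flat C {a..}"
  proof (rule ccontr)
    assume eU: "e \<notin> flat C {a..}"
    \<comment> \<open>The largest \<open>b\<close> in \<open>Q\<close> locates the outermost part:
      \<open>X\<close> lies in \<open>flat C {b..}\<close> but not in
      \<open>flat C {b<..}\<close>.\<close>
    define Q where "Q = {b\<in>E. supp X \<subseteq> flat C {b..}}"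
    have "E \<noteq> {}" using sX(2) XE by blast
    then have "Min E \<in> Q" using in_cyclic finite_E by (simp add: Q_def)
    moreover have fin: "finite Q" using finite_E by (simp add: Q_def)
    ultimately have b: "Max Q \<in> Q" by (intro Max_in) auto
    define b where "b = Max Q"
    have Xb: "supp X \<subseteq> flat C {b..}" using b by (auto simp: Q_def b_def)
    have ba: "b < a"
    proof (rule ccontr)
      assume "\<not> b < a"
      then have "flat C {b..} \<subseteq> flat C {a..}" by (intro flat_mono) auto
      then show False using Xb sX(2) eU by blast
    qed
    have "\<not> supp X \<subseteq> flat C {b<..}"
    proof
      assume sub: "supp X \<subseteq> flat C {b<..}"
      \<comment> \<open>\<open>c\<close> is the next element of \<open>E\<close> after
        \<open>b\<close>; it exists because \<open>supp X\<close> lies in \<open>{a..}\<close> and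
        \<open>b < a\<close>. It would contradict the choice of \<open>b\<close>.\<close>
      define c where "c = Min (E \<inter> {b<..})"
      have ne: "E \<inter> {b<..} \<noteq> {}" "finite (E \<inter> {b<..})"
        using XE sX ba finite_E by force+
      have cE: "c \<in> E" "b < c" using Min_in[OF ne(2,1)] by (auto simp: c_def)
      have "{b<..} \<inter> E \<subseteq> {c..}" using ne(2) by (auto simp: c_def)
      then have "flat C {b<..} \<subseteq> flat C {c..}" using flat_mono flat_Int_E by metis
      then have "c \<in> Q" using sub cE by (auto simp: Q_def)
      then show False using cE(2) Max_ge[OF fin, of c] by (simp add: b_def)
    qed
    then obtain x where x: "x \<in> supp X" "x \<notin> flat C {b<..}" by blast
    have above: "supp X \<subseteq> {b<..} \<inter> E" using sX(1) ba XE by fastforce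
    obtain Y where Y: "Y \<in> D" "x \<in> fst Y" "snd Y \<inter> ({b<..} \<inter> E) = {}"
      using paint_C[of "{b<..} \<inter> E" x] x above flat_Int_E by blast
    \<comment> \<open>\<open>Y\<close> is nonnegative above \<open>b\<close>, so orthogonality keeps
      it off every positive circuit there. Its intersection with \<open>X\<close> then lies in
      \<open>part C b\<close>, where \<open>X\<close> has constant sign.\<close>
    have "supp Y \<inter> flat C {b<..} = {}"
    proof (rule ccontr)
      assume "\<not> ?thesis"
      then obtain y where y: "y \<in> supp Y" "y \<in> flat C {b<..}" by blast
      obtain W where W: "W \<in> C" "snd W = {}" "y \<in> fst W" "supp W \<subseteq> {b<..}" "supp W = fst W"
        using in_flatE[OF y(2)] by metis
      have "supp W \<subseteq> {b<..} \<inter> E" using W supp_C by blast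
      then have "fst W \<inter> snd Y = {}" using Y(3) W(5) by blast
      then show False using orth[OF W(1) Y(1)] W(2,3) y(1) unfolding orthogonal_def supp_def by blast
    qed
    then have "supp X \<inter> supp Y \<subseteq> part C b" using Xb by (auto simp: part_def)
    then have "supp X \<inter> supp Y \<subseteq> A \<or> supp X \<inter> supp Y \<inter> A = {}"
      using part_C[of b] by blast
    then have "fst X \<inter> fst Y = {} \<or> snd X \<inter> fst Y = {}"
      using fst_X snd_X by (auto simp: supp_def)
    moreover have "supp X \<inter> snd Y = {}" using above Y(3) by blast
    ultimately show False
      using orth[OF XC Y(1)] x(1) Y(2) unfolding orthogonal_def supp_def by blast
  qed
qed

lemma flat_reorient: "flat (reorient A C) {a..} = flat C {a..}"
  using flat_subset_flat_reorient flat_reorient_subset_flat by blast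

end

section \<open>Active elements and parts\<close>

context signed_pair
begin

lemma Min_ge_iff_supp: "X \<in> C \<Longrightarrow> a \<le> Min (supp X) \<longleftrightarrow> supp X \<subseteq> {a..}"
  using supp_C[of X] by auto

lemma active_iff: "a \<in> active C \<longleftrightarrow> a \<in> flat C {a..}"
proof
  assume "a \<in> active C"
  then obtain X where X: "X \<in> C" "positive X" "a = Min (supp X)" by (auto simp: active_def)
  note s = supp_C[OF X(1)]
  have "a \<in> supp X" "supp X \<subseteq> {a..}" using s X(3) by auto
  then show "a \<in> flat C {a..}" using X unfolding flat_def by blast
next
  assume "a \<in> flat C {a..}"
  then obtain X where X: "X \<in> C" "positive X" "a \<in> supp X" "supp X \<subseteq> {a..}"
    unfolding flat_def by blast
  then have "Min (supp X) = a" using supp_C[OF X(1)] by (intro Min_eqI) auto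
  then show "a \<in> active C" using X unfolding active_def by blast
qed

lemma finite_active: "finite (active C)"
  using active_iff flat_subset_E finite_E by (meson finite_subset subset_iff)

lemma cyclic_flat_eq:
  "cyclic_flat C k =
     (if k < card (active C) then flat C {sorted_list_of_set (active C) ! k..} else {})"
  unfolding cyclic_flat_def flat_def using Min_ge_iff_supp by (auto cong: conj_cong)

lemma cyclic_part_eq: "cyclic_part C = (\<Union>a\<in>E. flat C {a..})"
proof
  show "(\<Union>a\<in>E. flat C {a..}) \<subseteq> cyclic_part C" unfolding cyclic_part_def flat_def by blast
  show "cyclic_part C \<subseteq> (\<Union>a\<in>E. flat C {a..})"
  proof
    fix x assume "x \<in> cyclic_part C"
    then obtain X where X: "X \<in> C" "positive X" "x \<in> supp X" unfolding cyclic_part_def by blast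
    note s = supp_C[OF X(1)]
    have "supp X \<subseteq> {Min (supp X)..}" "Min (supp X) \<in> E" using s(2) subsetD[OF s(1) Min_in[OF s(2,3)]] by auto
    then show "x \<in> (\<Union>a\<in>E. flat C {a..})" using X unfolding flat_def by blast
  qed
qed

text \<open>The least element of a positive circuit is active, so a circuit above entry
  \<open>k\<close> starts at entry \<open>k + 1\<close> or later. After the last entry there is
  none, which matches the default \<open>{}\<close>.\<close>

lemma cyclic_flat_Suc:
  assumes k: "k < card (active C)"
  shows "cyclic_flat C (Suc k) = flat C {sorted_list_of_set (active C) ! k<..}" (is "_ = flat C {?a<..}")
proof -
  let ?l = "sorted_list_of_set (active C)"
  have len: "length ?l = card (active C)" by simp
  have sorted: "sorted_wrt (<) ?l" by simp
  have Min_active: "\<exists>j>k. j < card (active C) \<and> ?l ! j = Min (supp X)"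
    if X: "X \<in> C" "positive X" "supp X \<subseteq> {?a<..}" for X
  proof -
    have "Min (supp X) \<in> active C" using X unfolding active_def by blast
    then have "Min (supp X) \<in> set ?l" using finite_active by simp
    then obtain j where j: "j < length ?l" "?l ! j = Min (supp X)" by (metis in_set_conv_nth)
    have "?a < Min (supp X)" using X supp_C[OF X(1)] by auto
    then have "\<not> j \<le> k" using j k len sorted_nth_mono[of ?l j k] sorted_sorted_list_of_set
      by (metis leD)
    then show ?thesis using j len by (metis not_le_imp_less)
  qed
  show ?thesis
  proof (cases "Suc k < card (active C)")
    case True
    have lt: "?a < ?l ! Suc k"
      using True sorted_wrt_nth_less[OF sorted, of k "Suc k"] by simp
    have "supp X \<subseteq> {?l ! Suc k..}" if X: "X \<in> C" "positive X" "supp X \<subseteq> {?a<..}" for X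
    proof -
      obtain j where j: "j > k" "j < card (active C)" "?l ! j = Min (supp X)"
        using Min_active[OF X] by blast
      then have "?l ! Suc k \<le> ?l ! j" by (intro sorted_nth_mono) auto
      then show ?thesis using Min_ge_iff_supp[OF X(1)] j(3) by simp
    qed
    then have "flat C {?a<..} \<subseteq> flat C {?l ! Suc k..}" unfolding flat_def by blast
    moreover have "flat C {?l ! Suc k..} \<subseteq> flat C {?a<..}" using lt by (intro flat_mono) auto
    ultimately show ?thesis using True by (simp add: cyclic_flat_eq)
  next
    case False
    then have "\<not> (X \<in> C \<and> positive X \<and> supp X \<subseteq> {?a<..})" for X
      using Min_active[of X] by fastforce
    then have "flat C {?a<..} = {}" unfolding flat_def by blast
    then show ?thesis using False by (simp add: cyclic_flat_eq)
  qed
qed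

lemma cyclic_parts_eq:
  "{cyclic_flat C (k - 1) - cyclic_flat C k | k. k \<in> {1..card (active C)}} = part C ` active C"
proof -
  let ?l = "sorted_list_of_set (active C)" and ?n = "card (active C)"
  have step: "cyclic_flat C k - cyclic_flat C (Suc k) = part C (?l ! k)" if "k < ?n" for k
    unfolding cyclic_flat_Suc[OF that] using that by (simp add: cyclic_flat_eq part_def)
  \<comment> \<open>Writing each index as a successor disposes of the truncated subtraction
    \<open>k - 1\<close>.\<close>
  have "{cyclic_flat C (k - 1) - cyclic_flat C k | k. k \<in> {1..?n}} =
      (\<lambda>k. cyclic_flat C (k - 1) - cyclic_flat C k) ` Suc ` {..<?n}"
    unfolding image_Suc_lessThan by blast
  also have "\<dots> = (\<lambda>k. part C (?l ! k)) ` {..<?n}"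
    unfolding image_image by (rule image_cong) (simp_all add: step)
  also have "\<dots> = part C ` set ?l"
    by (force simp: in_set_conv_nth)
  finally show ?thesis using finite_active by simp
qed

text \<open>No positive circuit inside \<open>{b..}\<close> contains a nonactive \<open>b\<close>,
  so the two flats in the difference coincide.\<close>

lemma part_nonactive: "b \<notin> active C \<Longrightarrow> part C b = {}"
proof -
  assume b: "b \<notin> active C"
  have "supp X \<subseteq> {b<..}" if X: "X \<in> C" "positive X" "supp X \<subseteq> {b..}" for X
  proof -
    have "b \<notin> supp X" using b X unfolding active_iff flat_def by blast
    then show ?thesis using X(3) by (force simp: less_le)
  qed
  then show ?thesis unfolding part_def flat_def by blast
qed

lemma part_nonempty: "b \<in> active C \<Longrightarrow> part C b \<noteq> {}"
  using active_iff[of b] flat_subset[of C "{b<..}"] by (auto simp: part_def)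

lemma part_disjoint:
  assumes "a \<noteq> b"
  shows "part C a \<inter> part C b = {}"
proof -
  have *: "part C a \<inter> part C b = {}" if "a < b" for a b
  proof -
    have "flat C {b..} \<subseteq> flat C {a<..}" using that by (intro flat_mono) auto
    then show ?thesis unfolding part_def by blast
  qed
  show ?thesis using *[of a b] *[of b a] assms by (metis Int_commute neqE)
qed

end

section \<open>Counting unions of parts, passing to complements, and the conclusion\<close>

lemma card_Unions_disjoint:
  assumes "finite P" "{} \<notin> P" "\<And>A B. A \<in> P \<Longrightarrow> B \<in> P \<Longrightarrow> A \<noteq> B \<Longrightarrow> A \<inter> B = {}"
  shows "card {\<Union>Q | Q. Q \<subseteq> P} = 2 ^ card P"
proof -
  have "Q \<subseteq> R" if QR: "Q \<subseteq> P" "R \<subseteq> P" "\<Union>Q = \<Union>R" for Q R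
  proof
    fix A assume A: "A \<in> Q"
    then have "A \<noteq> {}" using assms(2) QR(1) by blast
    then obtain x where x: "x \<in> A" by blast
    then obtain B where B: "B \<in> R" "x \<in> B" using A QR(3) by blast
    then have "A = B" using assms(3)[of A B] A x QR by blast
    then show "A \<in> R" using B by simp
  qed
  then have "inj_on Union (Pow P)" by (intro inj_onI) (metis PowD subset_antisym)
  then have "card (Union ` Pow P) = card (Pow P)" by (rule card_image)
  moreover have "Union ` Pow P = {\<Union>Q | Q. Q \<subseteq> P}" by blast
  ultimately show ?thesis using assms(1) by (simp add: card_Pow)
qed

lemma dual_active_eq: "dual_active E C = active (cocircuits E C)"
  by (simp add: dual_active_def active_def)

lemma acyclic_flat_eq: "acyclic_flat E C k = E - cyclic_flat (cocircuits E C) k"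
  by (simp add: acyclic_flat_def cyclic_flat_def dual_active_eq)

lemma active_parts_eq:
  assumes "oriented_matroid E C"
  shows "active_parts E C = part C ` active C \<union> part (cocircuits E C) ` dual_active E C"
proof -
  let ?D = "cocircuits E C"
  interpret signed_pair E C ?D using assms by (rule signed_pair_cocircuits)
  interpret S: signed_pair E ?D C by (rule signed_pair_swap) unfold_locales
  \<comment> \<open>Inclusion in \<open>E\<close> lets complementation reverse the differences of
    consecutive flats.\<close>
  have "cyclic_flat ?D k \<subseteq> E" for k using S.flat_subset_E by (auto simp: S.cyclic_flat_eq)
  then have "acyclic_flat E C k - acyclic_flat E C (k - 1) = cyclic_flat ?D (k - 1) - cyclic_flat ?D k" for k
    unfolding acyclic_flat_eq by blast
  then show ?thesis
    unfolding active_parts_def dual_active_eq by (simp only: cyclic_parts_eq S.cyclic_parts_eq)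
qed

theorem proposition4p8:
  fixes E :: "('a::linorder) set" and C :: "'a signed set"
  assumes "oriented_matroid E C"
  shows "card {\<Union>P | P. P \<subseteq> active_parts E C} = 2 ^ (card (dual_active E C) + card (active C)) \<and>
    (\<forall>P. P \<subseteq> active_parts E C \<longrightarrow>
       active_filtration E (reorient (\<Union>P) C) = active_filtration E C \<and>
       active_partition E (reorient (\<Union>P) C) = active_partition E C \<and>
       active (reorient (\<Union>P) C) = active C \<and>
       dual_active E (reorient (\<Union>P) C) = dual_active E C)"
proof -
  let ?D = "cocircuits E C"
  interpret signed_pair E C ?D using assms by (rule signed_pair_cocircuits)
  interpret S: signed_pair E ?D C by (rule signed_pair_swap) unfold_locales
  have parts: "active_parts E C = part C ` active C \<union> part ?D ` active ?D"
    using active_parts_eq[OF assms] by (simp add: dual_active_eq)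
  have CD: "part C a \<inter> part ?D b = {}" for a b
    using flats_disjoint unfolding part_def by blast
  have disj: "A \<inter> B = {}" if "A \<in> active_parts E C" "B \<in> active_parts E C" "A \<noteq> B" for A B
    using that unfolding parts
    by (elim UnE imageE) (metis part_disjoint S.part_disjoint CD Int_commute)+
  have ne: "{} \<notin> active_parts E C"
    unfolding parts using part_nonempty S.part_nonempty by auto
  have fin: "finite (active_parts E C)"
    unfolding parts using finite_active S.finite_active by simp
  have "card (active_parts E C) = card (part C ` active C) + card (part ?D ` active ?D)"
    unfolding parts
  proof (rule card_Un_disjoint)
    have "part C a \<noteq> part ?D b" if "a \<in> active C" for a b
      using CD[of a b] part_nonempty[OF that] by auto
    then show "part C ` active C \<inter> part ?D ` active ?D = {}" by blast
  qed (use finite_active S.finite_active in auto)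
  moreover have "inj_on (part C) (active C)"
    by (rule inj_onI) (metis inf.idem part_disjoint part_nonempty)
  moreover have "inj_on (part ?D) (active ?D)"
    by (rule inj_onI) (metis inf.idem S.part_disjoint S.part_nonempty)
  ultimately have "card (active_parts E C) = card (dual_active E C) + card (active C)"
    by (simp add: card_image dual_active_eq)
  then have count: "card {\<Union>P | P. P \<subseteq> active_parts E C} = 2 ^ (card (dual_active E C) + card (active C))"
    using card_Unions_disjoint[OF fin ne disj] by simp
  have "active_filtration E (reorient (\<Union>P) C) = active_filtration E C \<and>
       active_partition E (reorient (\<Union>P) C) = active_partition E C \<and>
       active (reorient (\<Union>P) C) = active C \<and>
       dual_active E (reorient (\<Union>P) C) = dual_active E C" if P: "P \<subseteq> active_parts E C" for P
  proof -
    let ?A = "\<Union>P"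
    let ?C' = "reorient ?A C" and ?D' = "reorient ?A ?D"
    have D': "cocircuits E ?C' = ?D'" by (rule cocircuits_reorient)
    have pair': "signed_pair E ?C' ?D'"
      using signed_pair_cocircuits[OF oriented_matroid_reorient[OF assms], of ?A] by (simp add: D')
    interpret R: signed_pair E ?C' ?D' by (rule pair')
    interpret RS: signed_pair E ?D' ?C' by (rule signed_pair_swap) (rule pair')
    \<comment> \<open>The empty case serves nonactive elements: their parts are empty and do not
      belong to the active partition.\<close>
    have sep: "B \<subseteq> ?A \<or> B \<inter> ?A = {}" if "B \<in> active_parts E C \<or> B = {}" for B
      using that disj P by blast
    have rp: "reoriented_pair E C ?D ?A"
    proof (intro reoriented_pair.intro reoriented_pair_axioms.intro signed_pair_axioms)
      show "part C b \<subseteq> ?A \<or> part C b \<inter> ?A = {}" for b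
        by (rule sep) (use part_nonactive[of b] parts in blast)
      show "part ?D b \<subseteq> ?A \<or> part ?D b \<inter> ?A = {}" for b
        by (rule sep) (use S.part_nonactive[of b] parts in blast)
      show "signed_pair E ?C' ?D'" by (rule pair')
    qed
    have fC: "flat ?C' {a..} = flat C {a..}" for a
      using reoriented_pair.flat_reorient[OF rp] .
    have fD: "flat ?D' {a..} = flat ?D {a..}" for a
      using reoriented_pair.flat_reorient[OF reoriented_pair_swap[OF rp]] .
    have act: "active ?C' = active C"
      by (simp add: set_eq_iff R.active_iff active_iff fC)
    have "active ?D' = active ?D"
      by (simp add: set_eq_iff RS.active_iff S.active_iff fD)
    then have dual: "dual_active E ?C' = dual_active E C" by (simp add: dual_active_eq D')
    have cf: "cyclic_flat ?C' = cyclic_flat C"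
      by (simp add: fun_eq_iff R.cyclic_flat_eq cyclic_flat_eq fC act)
    have af: "acyclic_flat E ?C' = acyclic_flat E C"
      using dual by (simp add: fun_eq_iff acyclic_flat_eq D' RS.cyclic_flat_eq S.cyclic_flat_eq fD
          dual_active_eq)
    have cp: "cyclic_part ?C' = cyclic_part C"
      by (simp add: R.cyclic_part_eq cyclic_part_eq fC)
    show ?thesis
      by (simp add: active_filtration_def active_partition_def active_parts_def act dual cf af cp)
  qed
  then show ?thesis using count by blast
qed

end
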